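(* Let $f\in L^1(\mathbb{R}^d)$, $f:\mathbb{R}^d\to\mathbb{R}$, be continuously differentiable with $L$-Lipschitz gradient, i.e. $\|\nabla f(x)-\nabla f(y)\|\le L\|x-y\|$ for all $x,y\in\mathbb{R}^d$, where $L>0$. Let $\{\phi_t\}_{t>0}$ be a nonnegative approximate identity on $\mathbb{R}^d$ and, for an integer $\nu\ge1$, let $f^\nu=f*\phi_{1/\nu}$. Then the gradient $\nabla f^\nu:\mathbb{R}^d\to\mathbb{R}^d$ is Lipschitz continuous with Lipschitz constant $L$.
   Context: A nonnegative approximate identity on $\mathbb{R}^d$ is a family of nonnegative $\phi_t\in L^1(\mathbb{R}^d)$, $t>0$, with $\int\phi_t=1$ for all $t$ and $\lim_{t\to0}\int_{|x|\ge\delta}\phi_t(x)\,dx=0$ for every $\delta>0$. $f^\nu(x)=\int_{\mathbb{R}^d}f(y)\phi_{1/\nu}(x-y)\,dy$, and its gradient is given by the Bochner integral $\nabla f^\nu(x)=\int_{\mathbb{R}^d}\nabla f(y)\phi_{1/\nu}(x-y)\,dy$. $\|\cdot\|$ is the Euclidean norm. *)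

theory Defs
  imports "HOL-Analysis.Analysis"
begin

definition gradient :: "('a::real_inner \<Rightarrow> real) \<Rightarrow> 'a \<Rightarrow> 'a" where
  "gradient f x = (THE D. GDERIV f x :> D)"

lemma gradient_eqI:
  assumes "GDERIV f x :> D"
  shows "gradient f x = D"
  unfolding gradient_def
proof (rule the_equality)
  fix E assume "GDERIV f x :> E"
  with assms have "(\<lambda>h. inner h E) = (\<lambda>h. inner h D)"
    unfolding gderiv_def by (rule has_derivative_unique[rotated])
  then show "E = D"
    by (metis vector_eq_ldot)
qed (fact assms)

lemma GDERIV_gradient:
  fixes f :: "'a::euclidean_space \<Rightarrow> real"
  assumes "f differentiable (at x)"
  shows "GDERIV f x :> gradient f x"
proof -
  obtain f' where f': "(f has_derivative f') (at x)"
    using assms by (auto simp: differentiable_def)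
  then have lin: "linear f'"
    by (rule has_derivative_linear)
  have "f' = (\<lambda>h. inner h (adjoint f' 1))"
    using adjoint_works[OF lin, of _ 1] by auto
  with f' have "GDERIV f x :> adjoint f' 1"
    by (simp add: gderiv_def)
  then show ?thesis
    using gradient_eqI by metis
qed

text \<open>Elements of \<open>L\<^sup>1\<close> are determined only up to null sets, so nonnegativity is required
  almost everywhere. Only the members with positive index are constrained.\<close>

definition nonneg_approx_identity :: "(real \<Rightarrow> 'a::euclidean_space \<Rightarrow> real) \<Rightarrow> bool" where
  "nonneg_approx_identity \<phi> \<longleftrightarrow>
     (\<forall>t>0. integrable lebesgue (\<phi> t) \<and> (AE x in lebesgue. 0 \<le> \<phi> t x) \<and>
            (LINT x|lebesgue. \<phi> t x) = 1) \<and>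
     (\<forall>\<delta>>0. ((\<lambda>t. LINT x:{x. \<delta> \<le> norm x}|lebesgue. \<phi> t x) \<longlongrightarrow> 0) (at_right 0))"

definition convolve ::
    "('a::euclidean_space \<Rightarrow> real) \<Rightarrow> ('a \<Rightarrow> real) \<Rightarrow> 'a \<Rightarrow> real" where
  "convolve f g x = (LINT y|lebesgue. f y * g (x - y))"

end

theory Submission
  imports Defs
begin

text \<open>
  After the substitution \<open>z = x - y\<close> the point \<open>x\<close> enters
  \<open>(f * \<phi>) x = (\<integral>z. f (x - z) * \<phi> z)\<close> only through \<open>f\<close>, so every estimate for \<open>f\<close> that is uniform in
  the base point can be averaged against the weight \<open>\<phi>\<close>, which is nonnegative and has total mass \<open>1\<close>.
  Two such estimates are used. The Lipschitz bound for the gradient passes to the average with the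
  same constant. The Taylor estimate \<open>\<bar>f (x + h) - f x - h \<bullet> \<nabla>f x\<bar> \<le> L * \<parallel>h\<parallel>\<^sup>2\<close> also passes to the
  average, and it says precisely that the average of \<open>\<nabla>f\<close> is the gradient of the average of \<open>f\<close>;
  hence no limit has to be interchanged with the integral.

  The remaining point is that these averages exist at \<^emph>\<open>every\<close> \<open>x\<close>, for which it suffices that \<open>f\<close> and
  \<open>\<nabla>f\<close> are bounded. This follows from \<open>f \<in> L\<^sup>1\<close>: by the Taylor estimate, a large value of \<open>f\<close> or of
  \<open>\<nabla>f\<close> at a point would force \<open>\<bar>f\<bar>\<close> to be large on a whole ball of fixed radius nearby
  (lemma \<open>value_and_gradient_bound\<close>).
\<close>

section \<open>Functions with Lipschitz gradient\<close>

lemma taylor_lipschitz_gradient: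
  fixes f :: "'a::euclidean_space \<Rightarrow> real"
  assumes diff: "\<And>x. f differentiable (at x)"
    and lip: "\<And>x y. norm (gradient f x - gradient f y) \<le> L * norm (x - y)"
    and "L \<ge> 0"
  shows "\<bar>f (x + h) - f x - h \<bullet> gradient f x\<bar> \<le> L * (norm h)\<^sup>2"
proof -
  have "norm (f (x + h) - f x - (x + h - x) \<bullet> gradient f x) \<le> norm (x + h - x) * (L * norm h)"
  proof (rule differentiable_bound_linearization[where S = "cball x (norm h)"
        and f' = "\<lambda>x h. h \<bullet> gradient f x"])
    fix t :: real assume "t \<in> {0..1}"
    then show "x + t *\<^sub>R (x + h - x) \<in> cball x (norm h)"
      by (simp add: dist_norm mult_left_le_one_le)
  next
    fix y
    show "(f has_derivative (\<lambda>h. h \<bullet> gradient f y)) (at y within cball x (norm h))"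
      using GDERIV_gradient[OF diff] unfolding gderiv_def by (rule has_derivative_at_withinI)
  next
    fix y assume y: "y \<in> cball x (norm h)"
    have "norm (gradient f y - gradient f x) \<le> L * norm (y - x)"
      by (rule lip)
    also have "\<dots> \<le> L * norm h"
      using y \<open>L \<ge> 0\<close> by (intro mult_left_mono) (auto simp: dist_norm norm_minus_commute)
    finally have *: "norm (gradient f y - gradient f x) \<le> L * norm h" .
    show "onorm ((\<lambda>h. h \<bullet> gradient f y) - (\<lambda>h. h \<bullet> gradient f x)) \<le> L * norm h"
    proof (rule onorm_le)
      fix k
      have "norm (k \<bullet> (gradient f y - gradient f x)) \<le> norm k * norm (gradient f y - gradient f x)"
        by (simp add: Cauchy_Schwarz_ineq2)
      also have "\<dots> \<le> norm k * (L * norm h)"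
        by (intro mult_left_mono *) auto
      finally show "norm (((\<lambda>h. h \<bullet> gradient f y) - (\<lambda>h. h \<bullet> gradient f x)) k) \<le> L * norm h * norm k"
        by (simp add: inner_diff_right mult_ac)
    qed
  qed auto
  then show ?thesis
    by (simp add: power2_eq_square mult_ac)
qed

text \<open>
  Among the two directions \<open>\<plusminus>\<nabla>f x\<close>, the one whose sign agrees with that of \<open>f x\<close> leads away from zero:
  moving about half a unit along it increases \<open>\<bar>f\<bar>\<close> by at least \<open>\<parallel>\<nabla>f x\<parallel> / 4\<close>, up to the Taylor error,
  which is at most \<open>L\<close>. The displacement consists of \<open>\<plusminus>sgn (\<nabla>f x) / 2\<close>, which gains \<open>\<parallel>\<nabla>f x\<parallel> / 2\<close>,
  and an arbitrary vector of norm below \<open>1/4\<close>, which loses at most half of that gain again. If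
  \<open>\<nabla>f x = 0\<close>, then \<open>sgn (\<nabla>f x) = 0\<close> and the ball is centred at \<open>x\<close>.
\<close>

lemma large_on_nearby_ball:
  fixes f :: "'a::euclidean_space \<Rightarrow> real"
  assumes diff: "\<And>x. f differentiable (at x)"
    and lip: "\<And>x y. norm (gradient f x - gradient f y) \<le> L * norm (x - y)"
    and "L \<ge> 0"
  shows "\<exists>p. \<forall>y\<in>ball p (1/4). \<bar>f x\<bar> + norm (gradient f x) / 4 - L \<le> \<bar>f y\<bar>"
proof -
  define g where "g = gradient f x"
  define s :: real where "s = (if f x \<ge> 0 then 1 else - 1)"
  have s: "\<bar>s\<bar> = 1" "s * s = 1" "s * f x = \<bar>f x\<bar>"
    by (auto simp: s_def)
  have "\<bar>f x\<bar> + norm g / 4 - L \<le> \<bar>f y\<bar>" if "y \<in> ball (x + (s / 2) *\<^sub>R sgn g) (1/4)" for y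
  proof -
    define k where "k = y - (x + (s / 2) *\<^sub>R sgn g)"
    define h where "h = (s / 2) *\<^sub>R sgn g + k"
    have y: "y = x + h"
      by (simp add: h_def k_def)
    have k: "norm k \<le> 1/4"
      using that by (simp add: k_def dist_norm norm_minus_commute)
    have "norm ((s / 2) *\<^sub>R sgn g) \<le> 1/2"
      using s(1) by (simp add: norm_sgn)
    then have "norm h \<le> 1"
      using k norm_triangle_ineq[of "(s / 2) *\<^sub>R sgn g" k] unfolding h_def by linarith
    then have "L * (norm h)\<^sup>2 \<le> L"
      using \<open>L \<ge> 0\<close> by (simp add: mult_left_le power_le_one)
    with taylor_lipschitz_gradient[OF diff lip \<open>L \<ge> 0\<close>, of x h]
    have taylor: "\<bar>f y - f x - h \<bullet> g\<bar> \<le> L"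
      by (simp add: y g_def)
    have "s * (h \<bullet> g) = (s * s) / 2 * (sgn g \<bullet> g) + s * (k \<bullet> g)"
      by (simp add: h_def inner_add_left algebra_simps)
    moreover have "sgn g \<bullet> g = norm g"
      by (cases "g = 0") (simp_all add: sgn_div_norm dot_square_norm power2_eq_square)
    moreover have "\<bar>s * (k \<bullet> g)\<bar> \<le> norm g / 4"
    proof -
      have "\<bar>s * (k \<bullet> g)\<bar> \<le> norm k * norm g"
        using s(1) by (simp add: abs_mult Cauchy_Schwarz_ineq2)
      also have "\<dots> \<le> 1/4 * norm g"
        using k by (intro mult_right_mono) auto
      finally show ?thesis by simp
    qed
    ultimately have "s * (h \<bullet> g) \<ge> norm g / 4"
      using s(2) by simp
    moreover have "\<bar>s * (f y - f x - h \<bullet> g)\<bar> \<le> L"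
      using taylor s(1) by (simp add: abs_mult)
    then have "s * f y \<ge> s * f x + s * (h \<bullet> g) - L"
      by (simp add: algebra_simps)
    moreover have "s * f y \<le> \<bar>f y\<bar>"
      by (auto simp: s_def)
    ultimately show ?thesis
      using s(3) by linarith
  qed
  then show ?thesis
    unfolding g_def by blast
qed

text \<open>
  The ball found above has a radius that does not depend on \<open>x\<close>, so integrating the lower bound over
  it turns \<open>\<integral>\<bar>f\<bar> < \<infinity>\<close> into a bound that is uniform in \<open>x\<close>.
\<close>

lemma value_and_gradient_bound:
  fixes f :: "'a::euclidean_space \<Rightarrow> real"
  assumes int: "integrable lebesgue f"
    and diff: "\<And>x. f differentiable (at x)"
    and lip: "\<And>x y. norm (gradient f x - gradient f y) \<le> L * norm (x - y)"
    and "L \<ge> 0"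
  shows "\<bar>f x\<bar> + norm (gradient f x) / 4
           \<le> L + (LINT y|lebesgue. \<bar>f y\<bar>) / measure lborel (ball (0::'a) (1/4))"
proof -
  define c where "c = \<bar>f x\<bar> + norm (gradient f x) / 4 - L"
  obtain p where p: "\<forall>y\<in>ball p (1/4). c \<le> \<bar>f y\<bar>"
    using large_on_nearby_ball[OF diff lip \<open>L \<ge> 0\<close>, of x] unfolding c_def by blast
  have "measure lborel (ball p (1/4)) * c = (LINT y|lebesgue. indicator (ball p (1/4)) y *\<^sub>R c)"
    by simp
  also have "\<dots> \<le> (LINT y|lebesgue. \<bar>f y\<bar>)"
  proof (rule integral_mono)
    show "integrable lebesgue (\<lambda>y. indicator (ball p (1/4)) y *\<^sub>R c)"
      by (intro integrable_scaleR_left integrable_real_indicator)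
        (use emeasure_lborel_ball_finite[of p "1/4"] in \<open>auto simp: top.not_eq_extremum\<close>)
    show "integrable lebesgue (\<lambda>y. \<bar>f y\<bar>)"
      using int by (rule integrable_abs)
  qed (use p in \<open>auto simp: indicator_def\<close>)
  also have "measure lborel (ball p (1/4)) = measure lborel (ball (0::'a) (1/4))"
    by (simp add: content_ball_conv_unit_ball[of "1/4" p] content_ball_conv_unit_ball[of "1/4" 0])
  finally have "c \<le> (LINT y|lebesgue. \<bar>f y\<bar>) / measure lborel (ball (0::'a) (1/4))"
    using content_ball_pos[of "1/4" "0::'a"] by (simp add: pos_le_divide_eq mult.commute)
  then show ?thesis
    by (simp add: c_def)
qed

section \<open>Averages against a weight\<close>

lemma distr_lebesgue_reflect: "distr lebesgue lebesgue (\<lambda>z. x - z) = (lebesgue :: 'a::euclidean_space measure)"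
  and measurable_lebesgue_reflect: "(\<lambda>z. x - z) \<in> (lebesgue :: 'a measure) \<rightarrow>\<^sub>M lebesgue"
proof -
  have T: "(\<lambda>z. x + (\<Sum>j\<in>Basis. (- 1 * (z \<bullet> j)) *\<^sub>R j)) = (\<lambda>z. x - z)"
    by (simp add: sum_negf euclidean_representation)
  show "distr lebesgue lebesgue (\<lambda>z. x - z) = (lebesgue :: 'a measure)"
    using lebesgue_affine_euclidean[of "\<lambda>_. - 1" x] unfolding T by (simp add: density_1)
  show "(\<lambda>z. x - z) \<in> (lebesgue :: 'a measure) \<rightarrow>\<^sub>M lebesgue"
    using lebesgue_affine_measurable[of "\<lambda>_. - 1" x] unfolding T by simp
qed

lemma lebesgue_integral_reflect:
  fixes F :: "'a::euclidean_space \<Rightarrow> 'b::{banach, second_countable_topology}"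
  assumes "F \<in> borel_measurable lebesgue"
  shows "(LINT y|lebesgue. F (x - y)) = (LINT z|lebesgue. F z)"
  using integral_distr[OF measurable_lebesgue_reflect assms, of x]
  by (simp add: distr_lebesgue_reflect)

lemma integrable_weight_bounded_continuous:
  fixes F :: "'a::euclidean_space \<Rightarrow> 'b::{banach, second_countable_topology}"
  assumes w: "integrable lebesgue w"
    and cont: "continuous_on UNIV F"
    and bound: "\<And>x. norm (F x) \<le> M"
  shows "integrable lebesgue (\<lambda>z. w z *\<^sub>R F (x - z))"
proof (rule Bochner_Integration.integrable_bound)
  show "integrable lebesgue (\<lambda>z. M * w z)"
    using w by simp
  have "continuous_on UNIV (\<lambda>z. F (x - z))"
    by (intro continuous_on_compose2[OF cont] continuous_intros) auto
  then have "(\<lambda>z. F (x - z)) \<in> borel_measurable lebesgue"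
    by (intro measurable_completion) (simp add: borel_measurable_continuous_onI)
  then show "(\<lambda>z. w z *\<^sub>R F (x - z)) \<in> borel_measurable lebesgue"
    using w by (intro borel_measurable_scaleR) auto
  have "\<bar>w z\<bar> * norm (F (x - z)) \<le> \<bar>w z\<bar> * \<bar>M\<bar>" for z
    by (intro mult_left_mono order.trans[OF bound]) auto
  then show "AE z in lebesgue. norm (w z *\<^sub>R F (x - z)) \<le> norm (M * w z)"
    by (simp add: abs_mult mult.commute)
qed

lemma norm_average_le:
  fixes F :: "'a \<Rightarrow> 'b::{banach, second_countable_topology}"
  assumes w: "integrable N w" "AE z in N. 0 \<le> w z" "(LINT z|N. w z) = 1"
    and int: "integrable N (\<lambda>z. w z *\<^sub>R F z)"
    and bound: "\<And>z. norm (F z) \<le> C"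
  shows "norm (LINT z|N. w z *\<^sub>R F z) \<le> C"
proof -
  have "norm (LINT z|N. w z *\<^sub>R F z) \<le> (LINT z|N. norm (w z *\<^sub>R F z))"
    by (rule integral_norm_bound)
  also have "\<dots> \<le> (LINT z|N. w z * C)"
  proof (rule integral_mono_AE)
    show "AE z in N. norm (w z *\<^sub>R F z) \<le> w z * C"
      using w(2) by eventually_elim (auto intro: mult_left_mono bound)
  qed (use w(1) integrable_norm[OF int] in auto)
  also have "\<dots> = C"
    using w(3) by simp
  finally show ?thesis .
qed

lemma convolve_eq_average:
  fixes F :: "'a::euclidean_space \<Rightarrow> 'b::{banach, second_countable_topology}"
  assumes "integrable lebesgue (\<lambda>z. w z *\<^sub>R F (x - z))"
  shows "(LINT y|lebesgue. w (x - y) *\<^sub>R F y) = (LINT z|lebesgue. w z *\<^sub>R F (x - z))"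
  using lebesgue_integral_reflect[OF borel_measurable_integrable[OF assms], of x] by simp

text \<open>
  The Taylor estimate in this converse form identifies the gradient of the averaged function.
\<close>

lemma gderiv_if_quadratic_remainder:
  fixes u :: "'a::real_inner \<Rightarrow> real"
  assumes "\<And>h. \<bar>u (x + h) - u x - h \<bullet> D\<bar> \<le> C * (norm h)\<^sup>2"
  shows "GDERIV u x :> D"
  unfolding gderiv_def has_derivative_at
proof
  show "bounded_linear (\<lambda>h. h \<bullet> D)"
    by (rule bounded_linear_inner_left)
  show "(\<lambda>h. norm (u (x + h) - u x - h \<bullet> D) / norm h) \<midarrow>0\<rightarrow> 0"
  proof (rule Lim_null_comparison)
    have "norm (norm (u (x + h) - u x - h \<bullet> D) / norm h) \<le> C * norm h" for h
      using assms[of h] by (cases "h = 0") (auto simp: divide_le_eq power2_eq_square mult_ac)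
    then show "\<forall>\<^sub>F h in at 0. norm (norm (u (x + h) - u x - h \<bullet> D) / norm h) \<le> C * norm h"
      by simp
    show "((\<lambda>h::'a. C * norm h) \<longlongrightarrow> 0) (at 0)"
      by (auto intro!: tendsto_eq_intros)
  qed
qed

section \<open>The mollified function\<close>

theorem lemma3p2:
  fixes f :: "real ^ 'd \<Rightarrow> real"
    and \<phi> :: "real \<Rightarrow> real ^ 'd \<Rightarrow> real"
    and L :: real and \<nu> :: nat
  assumes "integrable lebesgue f"
    and "\<And>x. f differentiable (at x)"
    and "continuous_on UNIV (gradient f)"
    and "L > 0"
    and "\<And>x y. norm (gradient f x - gradient f y) \<le> L * norm (x - y)"
    and "nonneg_approx_identity \<phi>"
    and "\<nu> \<ge> 1"
  shows "(\<forall>x. GDERIV (convolve f (\<phi> (1 / real \<nu>))) x :>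
              (LINT y|lebesgue. \<phi> (1 / real \<nu>) (x - y) *\<^sub>R gradient f y)) \<and>
         L-lipschitz_on UNIV (gradient (convolve f (\<phi> (1 / real \<nu>))))"
proof -
  define w where "w = \<phi> (1 / real \<nu>)"
  define u where "u = convolve f w"
  define G where "G x = (LINT y|lebesgue. w (x - y) *\<^sub>R gradient f y)" for x
  have "1 / real \<nu> > 0"
    using assms(7) by simp
  then have w: "integrable lebesgue w" "AE z in lebesgue. 0 \<le> w z" "(LINT z|lebesgue. w z) = 1"
    using assms(6) by (auto simp: nonneg_approx_identity_def w_def)
  define B where "B = L + (LINT y|lebesgue. \<bar>f y\<bar>) / measure lborel (ball (0 :: real ^ 'd) (1/4))"
  have bound: "\<bar>f x\<bar> + norm (gradient f x) / 4 \<le> B" for x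
    unfolding B_def using assms by (intro value_and_gradient_bound) auto
  have f_bound: "norm (f x) \<le> B" and grad_bound: "norm (gradient f x) \<le> 4 * B" for x
    using bound[of x] norm_ge_zero[of "gradient f x"] abs_ge_zero[of "f x"]
    unfolding real_norm_def by linarith+
  have f_cont: "continuous_on UNIV f"
    using assms(2) by (simp add: continuous_at_imp_continuous_on differentiable_imp_continuous_within)
  note int_f = integrable_weight_bounded_continuous[OF w(1) f_cont f_bound]
  note int_grad = integrable_weight_bounded_continuous[OF w(1) assms(3) grad_bound]
  have u: "u x = (LINT z|lebesgue. w z *\<^sub>R f (x - z))" for x
    using convolve_eq_average[OF int_f[of x]] by (simp add: u_def convolve_def mult.commute)
  have G: "G x = (LINT z|lebesgue. w z *\<^sub>R gradient f (x - z))" for x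
    using convolve_eq_average[OF int_grad[of x]] by (simp add: G_def)

  \<comment> \<open>The remainder of \<open>u\<close> at \<open>x\<close> is the average of the remainders of \<open>f\<close> at the points \<open>x - z\<close>.\<close>
  have gderiv: "GDERIV u x :> G x" for x
  proof (rule gderiv_if_quadratic_remainder)
    fix h :: "real ^ 'd"
    let ?R = "\<lambda>z. f (x + h - z) - f (x - z) - h \<bullet> gradient f (x - z)"
    have R: "w z *\<^sub>R ?R z
        = w z *\<^sub>R f (x + h - z) - w z *\<^sub>R f (x - z) - h \<bullet> (w z *\<^sub>R gradient f (x - z))" for z
      by (simp add: algebra_simps)
    have int_R: "integrable lebesgue (\<lambda>z. w z *\<^sub>R ?R z)"
      unfolding R by (intro Bochner_Integration.integrable_diff integrable_inner_right int_f int_grad)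
    have "u (x + h) - u x - h \<bullet> G x = (LINT z|lebesgue. w z *\<^sub>R ?R z)"
      unfolding R u G
      using int_f[of "x + h"] int_f[of x] int_grad[of x] by (simp del: real_scaleR_def inner_scaleR_right)
    moreover have "norm (?R z) \<le> L * (norm h)\<^sup>2" for z
      using taylor_lipschitz_gradient[OF assms(2,5), of "x - z" h] assms(4)
      by (simp add: algebra_simps)
    ultimately show "\<bar>u (x + h) - u x - h \<bullet> G x\<bar> \<le> L * (norm h)\<^sup>2"
      using norm_average_le[OF w int_R] by simp
  qed

  have "L-lipschitz_on UNIV G"
  proof (rule lipschitz_onI)
    fix x y
    let ?D = "\<lambda>z. gradient f (x - z) - gradient f (y - z)"
    have int_D: "integrable lebesgue (\<lambda>z. w z *\<^sub>R ?D z)"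
      unfolding scaleR_diff_right by (intro Bochner_Integration.integrable_diff int_grad)
    have "G x - G y = (LINT z|lebesgue. w z *\<^sub>R ?D z)"
      using int_grad[of x] int_grad[of y] by (simp add: G scaleR_diff_right)
    moreover have "norm (?D z) \<le> L * norm (x - y)" for z
      using assms(5)[of "x - z" "y - z"] by simp
    ultimately show "dist (G x) (G y) \<le> L * dist x y"
      using norm_average_le[OF w int_D] by (simp add: dist_norm)
  qed (use assms(4) in simp)
  moreover have "gradient u = G"
    using gderiv gradient_eqI by blast
  ultimately show ?thesis
    using gderiv unfolding u_def G_def w_def by simp
qed

end
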